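(* Let $\mathit{Var}$ be finite and $M$ a commutative complete quantale. Over the multiset object $\mathcal U_{\mathbb N}$, for every affine labelling $\sigma:\mathit{Var}\to M_1$, with $\alpha^{\mathbb N}_\sigma:\mathcal U_{\mathbb N}\to M$ the map $\alpha^{\mathbb N}_\sigma(\mathbb M)=\bigvee_{m\in\mathbb M}\bigotimes_v\sigma(v)^{m(v)}$: (1) $\alpha^{\mathbb N}_\sigma$ and its right adjoint $\gamma^{\mathbb N}_\sigma$ are both monotone, lax monoidal ($f(a)\otimes f(b)\sqsubseteq f(a\otimes b)$) and lax unital ($1\sqsubseteq f(1)$); (2) canonical derivations hold in both directions; (3) for every command $C$ and $\Gamma':\mathit{Var}\to M_1$, $1\vdash_M\sigma\{C\}\Gamma'$ is derivable iff $\alpha^{\mathbb N}_\sigma\circ\Delta^{\mathbb N}_C\sqsubseteq\Gamma'$ pointwise, so $\Delta^{\mathbb N}_C$ is a principal typing; (4) no member of the family certifies more $M$-typings than the $M$-system itself.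
   Context: Quantales. A commutative complete quantale $\langle M,\sqsubseteq,\bigvee,\otimes,1\rangle$ is a complete lattice with a commutative monoid $(\otimes,1)$ such that $\otimes$ distributes over arbitrary joins. $M_1=\{m\mid 1\sqsubseteq m\}$ (the affine elements). $m^0=1$, $m^n$ is the $n$-fold tensor power, $m^*=\bigvee_{n\ge0}m^n$. Empty tensors are $1$. Multiset object. $\mathcal U_{\mathbb N}=\mathcal U_{\mathbb N}(\mathit{Var})$ is the set of downsets of $(\mathbb N^{\mathit{Var}},\le)$ ordered by inclusion, with $\bigvee=\bigcup$, $\mathbb M\otimes\mathbb N={\downarrow}\{m+n\mid m\in\mathbb M,n\in\mathbb N\}$, $1={\downarrow}0$; generators $\hat v={\downarrow}e_v$ ($e_v$ the unit vector at $v$). It is a commutative complete quantale. Language. Commands: $\mathsf{skip}$, $x:=E$, $C_1;C_2$, $\mathsf{if}\;E\;C_1\;C_2$, $\mathsf{while}\;E\;C$; $\mathit{fv}(E)$ is the set of variables of $E$, $\mathit{asgn}(C)$ the set of variables assigned in $C$. The family of type systems. There is one system for each commutative complete quantale $M$ (the "$M$-system"), and these systems are the members of the family. $\Gamma:\mathit{Var}\to M_1$, $p\in M_1$, $t_E(\Gamma)=\bigotimes_{v\in\mathit{fv}(E)}\Gamma(v)$. Derivability $p\vdash_M\Gamma\{C\}\Gamma'$ is generated by: (Skip) $p\vdash\Gamma\{\mathsf{skip}\}\Gamma$. (Assign) $p\vdash\Gamma\{x:=E\}\Gamma[x\mapsto p\otimes t_E(\Gamma)]$. (Seq) from $p\vdash\Gamma\{C_1\}\Gamma''$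 and $p\vdash\Gamma''\{C_2\}\Gamma'$ infer $p\vdash\Gamma\{C_1;C_2\}\Gamma'$. (If) with $t=t_E(\Gamma)$, from $p\otimes t\vdash\Gamma\{C_i\}\Gamma_i'$ ($i=1,2$) infer $p\vdash\Gamma\{\mathsf{if}\;E\;C_1\;C_2\}\Gamma'$ where $\Gamma'(x)=t\otimes(\Gamma_1'(x)\vee\Gamma_2'(x))$ for $x\in\mathit{asgn}(C_1)\cup\mathit{asgn}(C_2)$ and $\Gamma'(x)=\Gamma(x)$ otherwise. (While) with $t=t_E(\Gamma)$, from $p\otimes t\vdash\Gamma\{C\}\Gamma$ infer $p\vdash\Gamma\{\mathsf{while}\;E\;C\}\Gamma^\dagger$ where $\Gamma^\dagger(x)=t^*\otimes\Gamma(x)$ for $x\in\mathit{asgn}(C)$ and $\Gamma^\dagger(x)=\Gamma(x)$ otherwise. (Sub) from $p\vdash\Gamma\{C\}\Gamma_1'$, $p'\sqsubseteq p$, $\Gamma'\sqsubseteq\Gamma$, $\Gamma_1'\sqsubseteq\Gamma_2'$ infer $p'\vdash\Gamma'\{C\}\Gamma_2'$. Algorithmic system. $\mathcal A^C_M(p,\Gamma):\mathit{Var}\to M_1$ is defined by recursion on $C$: $\Gamma$ for $\mathsf{skip}$; $\Gamma[x\mapsto p\otimes t_E(\Gamma)]$ for $x:=E$; $\mathcal A^{C_2}(p,\mathcal A^{C_1}(p,\Gamma))$ for $C_1;C_2$; for $\mathsf{if}\;E\;C_1\;C_2$, with $t=t_E(\Gamma)$, $\Gamma_i'=\mathcal A^{C_i}(p\otimes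 t,\Gamma)$, the environment $x\mapsto t\otimes(\Gamma_1'(x)\vee\Gamma_2'(x))$ for $x\in\mathit{asgn}(C_1)\cup\mathit{asgn}(C_2)$ and $x\mapsto\Gamma(x)$ otherwise; for $\mathsf{while}\;E\;C$, with $\Gamma^*$ the least fixed point of $\Theta\mapsto\Gamma\vee\mathcal A^C(p\otimes t_E(\Theta),\Theta)$ and $t=t_E(\Gamma^* )$, the environment $x\mapsto t^*\otimes\Gamma^*(x)$ for $x\in\mathit{asgn}(C)$ and $x\mapsto\Gamma^*(x)$ otherwise. $\Delta^{\mathbb N}_C=\mathcal A^C_{\mathcal U_{\mathbb N}}(1,\Delta_0)$ with $\Delta_0(v)=\hat v$. Terminology. "Canonical derivations" refers to passing between derivations of $1\vdash_M\sigma\{C\}\Gamma'$ in the $M$-system and universal derivations (derivations in the $\mathcal U_{\mathbb N}$-system from $\Delta_0$ with context $1$) whose postcondition is below $\gamma^{\mathbb N}_\sigma\circ\Gamma'$: in one direction an $M$-derivation is renamed along $\gamma^{\mathbb N}_\sigma$ and tightened with (Sub), using $\hat v\sqsubseteq\gamma^{\mathbb N}_\sigma(\sigma(v))$; in the other a universal derivation is renamed along $\alpha^{\mathbb N}_\sigma$ and the counit is applied. Item (4) is called internal completeness; it is the statement that the bound given by the principal typing in (3) is attained in the $M$-system. *)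

theory Defs
  imports Main
begin

section \<open>Commutative complete quantales\<close>

text \<open>The tensor and its unit are \<open>*\<close> and \<open>1\<close>, so tensor powers and finite tensors are the library's
  \<open>^\<close> and \<open>prod\<close>. By commutativity one distributive law suffices.\<close>

class comm_quantale = complete_lattice + comm_monoid_mult +
  assumes mult_Sup_distrib: "a * Sup B = (SUP b\<in>B. a * b)"

definition qstar :: "'m::comm_quantale \<Rightarrow> 'm" where
  "qstar m = (SUP n::nat. m ^ n)"

definition affine :: "'m::comm_quantale set" where
  "affine = {m. 1 \<le> m}"

text \<open>Environments \<open>Var \<rightarrow> M\<^sub>1\<close> are functions into \<open>M\<close> all of whose values are affine.\<close>

definition affine_env :: "('v \<Rightarrow> 'm::comm_quantale) \<Rightarrow> bool" where
  "affine_env \<Gamma> \<longleftrightarrow> range \<Gamma> \<subseteq> affine"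

definition lax :: "('m::comm_quantale \<Rightarrow> 'n::comm_quantale) \<Rightarrow> bool" where
  "lax f \<longleftrightarrow> mono f \<and> (\<forall>a b. f a * f b \<le> f (a * b)) \<and> 1 \<le> f 1"

section \<open>The multiset object\<close>

typedef 'v mdown = "{A :: ('v \<Rightarrow> nat) set. \<forall>m\<in>A. \<forall>n\<le>m. n \<in> A}"
  by blast

setup_lifting type_definition_mdown

instantiation mdown :: (type) comm_quantale
begin

lift_definition less_eq_mdown :: "'a mdown \<Rightarrow> 'a mdown \<Rightarrow> bool" is "(\<subseteq>)" .
lift_definition less_mdown :: "'a mdown \<Rightarrow> 'a mdown \<Rightarrow> bool" is "(\<subset>)" .
lift_definition sup_mdown :: "'a mdown \<Rightarrow> 'a mdown \<Rightarrow> 'a mdown" is "(\<union>)" by blast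
lift_definition inf_mdown :: "'a mdown \<Rightarrow> 'a mdown \<Rightarrow> 'a mdown" is "(\<inter>)" by blast
lift_definition Sup_mdown :: "'a mdown set \<Rightarrow> 'a mdown" is "\<Union>" by blast
lift_definition Inf_mdown :: "'a mdown set \<Rightarrow> 'a mdown" is "\<Inter>" by blast
lift_definition top_mdown :: "'a mdown" is "UNIV" by blast
lift_definition bot_mdown :: "'a mdown" is "{}" by blast

lift_definition one_mdown :: "'a mdown" is "{k. k \<le> (\<lambda>_. 0)}"
  by (auto intro: order_trans)

lift_definition times_mdown :: "'a mdown \<Rightarrow> 'a mdown \<Rightarrow> 'a mdown"
  is "\<lambda>A B. {k. \<exists>m\<in>A. \<exists>n\<in>B. k \<le> (\<lambda>v. m v + n v)}"
  by clarsimp (meson order_trans)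

instance
proof
  note order = less_eq_mdown.rep_eq less_mdown.rep_eq sup_mdown.rep_eq inf_mdown.rep_eq
    Sup_mdown.rep_eq Inf_mdown.rep_eq top_mdown.rep_eq bot_mdown.rep_eq
  fix a b c :: "'a mdown" and A B :: "'a mdown set"
  show "a < b \<longleftrightarrow> a \<le> b \<and> \<not> b \<le> a" by (simp add: order less_le_not_le)
  show "a \<le> a" by (simp add: order)
  show "a \<le> b \<Longrightarrow> b \<le> c \<Longrightarrow> a \<le> c" by (simp add: order)
  show "a \<le> b \<Longrightarrow> b \<le> a \<Longrightarrow> a = b" by (simp add: order Rep_mdown_inject[symmetric])
  show "inf a b \<le> a" "inf a b \<le> b" by (simp_all add: order)
  show "a \<le> b \<Longrightarrow> a \<le> c \<Longrightarrow> a \<le> inf b c" by (simp add: order)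
  show "a \<le> sup a b" "b \<le> sup a b" by (simp_all add: order)
  show "b \<le> a \<Longrightarrow> c \<le> a \<Longrightarrow> sup b c \<le> a" by (simp add: order)
  show "a \<in> A \<Longrightarrow> Inf A \<le> a" by (auto simp: order)
  show "(\<And>x. x \<in> A \<Longrightarrow> a \<le> x) \<Longrightarrow> a \<le> Inf A" by (auto simp: order)
  show "a \<in> A \<Longrightarrow> a \<le> Sup A" by (auto simp: order)
  show "(\<And>x. x \<in> A \<Longrightarrow> x \<le> a) \<Longrightarrow> Sup A \<le> a" by (auto simp: order)
  show "Inf {} = (top :: 'a mdown)" by (simp add: order Rep_mdown_inject[symmetric])
  show "Sup {} = (bot :: 'a mdown)" by (simp add: order Rep_mdown_inject[symmetric])
  show "a * b * c = a * (b * c)"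
  proof (transfer, intro set_eqI iffI)
    fix A B C :: "('a \<Rightarrow> nat) set" and k
    assume "k \<in> {k. \<exists>m\<in>{k. \<exists>m\<in>A. \<exists>n\<in>B. k \<le> (\<lambda>v. m v + n v)}. \<exists>n\<in>C. k \<le> (\<lambda>v. m v + n v)}"
    then obtain m x y n where *: "x \<in> A" "y \<in> B" "n \<in> C"
      "m \<le> (\<lambda>v. x v + y v)" "k \<le> (\<lambda>v. m v + n v)" by blast
    have k: "k \<le> (\<lambda>v. x v + (y v + n v))"
    proof (rule le_funI)
      fix v show "k v \<le> x v + (y v + n v)"
        using le_funD[OF *(4), of v] le_funD[OF *(5), of v] by simp
    qed
    show "k \<in> {k. \<exists>m\<in>A. \<exists>n\<in>{k. \<exists>m\<in>B. \<exists>n\<in>C. k \<le> (\<lambda>v. m v + n v)}. k \<le> (\<lambda>v. m v + n v)}"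
      by (rule CollectI, rule bexI[where x = x], rule bexI[where x = "\<lambda>v. y v + n v"]) (use * k in auto)
  next
    fix A B C :: "('a \<Rightarrow> nat) set" and k
    assume "k \<in> {k. \<exists>m\<in>A. \<exists>n\<in>{k. \<exists>m\<in>B. \<exists>n\<in>C. k \<le> (\<lambda>v. m v + n v)}. k \<le> (\<lambda>v. m v + n v)}"
    then obtain m x y n where *: "x \<in> A" "y \<in> B" "n \<in> C"
      "m \<le> (\<lambda>v. y v + n v)" "k \<le> (\<lambda>v. x v + m v)" by blast
    have k: "k \<le> (\<lambda>v. (x v + y v) + n v)"
    proof (rule le_funI)
      fix v show "k v \<le> (x v + y v) + n v"
        using le_funD[OF *(4), of v] le_funD[OF *(5), of v] by simp
    qed
    show "k \<in> {k. \<exists>m\<in>{k. \<exists>m\<in>A. \<exists>n\<in>B. k \<le> (\<lambda>v. m v + n v)}. \<exists>n\<in>C. k \<le> (\<lambda>v. m v + n v)}"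
      by (rule CollectI, rule bexI[where x = "\<lambda>v. x v + y v"], rule bexI[where x = n]) (use * k in auto)
  qed
  show "a * b = b * a"
    by (subst Rep_mdown_inject[symmetric], unfold times_mdown.rep_eq, subst add.commute) blast
  show "1 * a = a"
  proof (transfer, intro set_eqI iffI)
    fix A :: "('a \<Rightarrow> nat) set" and k
    assume down: "\<forall>m\<in>A. \<forall>n\<le>m. n \<in> A"
      and "k \<in> {k. \<exists>m\<in>{k. k \<le> (\<lambda>_. 0)}. \<exists>n\<in>A. k \<le> (\<lambda>v. m v + n v)}"
    then obtain m n where *: "m \<le> (\<lambda>_. 0)" "n \<in> A" "k \<le> (\<lambda>v. m v + n v)" by blast
    have "k \<le> n"
    proof (rule le_funI)
      fix v show "k v \<le> n v" using le_funD[OF *(1), of v] le_funD[OF *(3), of v] by simp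
    qed
    with down *(2) show "k \<in> A" by blast
  next
    fix A :: "('a \<Rightarrow> nat) set" and k
    assume k: "k \<in> A"
    show "k \<in> {k. \<exists>m\<in>{k. k \<le> (\<lambda>_. 0)}. \<exists>n\<in>A. k \<le> (\<lambda>v. m v + n v)}"
      by (rule CollectI, rule bexI[where x = "\<lambda>_. 0"], rule bexI[where x = k]) (use k in auto)
  qed
  show "a * Sup B = (SUP b\<in>B. a * b)"
    by (simp add: Rep_mdown_inject[symmetric] times_mdown.rep_eq Sup_mdown.rep_eq) blast
qed

end

lift_definition gen :: "'v \<Rightarrow> 'v mdown" is "\<lambda>v. {k. k \<le> (\<lambda>w. if w = v then 1 else 0)}"
  by (auto intro: order_trans)

definition alpha :: "('v::finite \<Rightarrow> 'm::comm_quantale) \<Rightarrow> 'v mdown \<Rightarrow> 'm" where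
  "alpha \<sigma> A = (SUP m\<in>Rep_mdown A. \<Prod>v\<in>UNIV. \<sigma> v ^ m v)"

text \<open>The right adjoint of \<open>alpha \<sigma>\<close>, which preserves unions.\<close>

definition gamma :: "('v::finite \<Rightarrow> 'm::comm_quantale) \<Rightarrow> 'm \<Rightarrow> 'v mdown" where
  "gamma \<sigma> x = Sup {A. alpha \<sigma> A \<le> x}"

section \<open>The language\<close>

text \<open>Expressions are an arbitrary type \<open>'e\<close>; the type systems only see them through a
  free-variable function \<open>fv :: 'e \<Rightarrow> 'v set\<close>, which is a parameter throughout.\<close>

datatype ('v, 'e) com =
    Skip
  | Assign 'v 'e
  | Seq "('v, 'e) com" "('v, 'e) com"
  | Cond 'e "('v, 'e) com" "('v, 'e) com"
  | While 'e "('v, 'e) com"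

primrec asgn :: "('v, 'e) com \<Rightarrow> 'v set" where
  "asgn Skip = {}"
| "asgn (Assign x E) = {x}"
| "asgn (Seq C1 C2) = asgn C1 \<union> asgn C2"
| "asgn (Cond E C1 C2) = asgn C1 \<union> asgn C2"
| "asgn (While E C) = asgn C"

section \<open>The family of type systems\<close>

definition texp :: "('e \<Rightarrow> 'v::finite set) \<Rightarrow> 'e \<Rightarrow> ('v \<Rightarrow> 'm::comm_quantale) \<Rightarrow> 'm" where
  "texp fv E \<Gamma> = (\<Prod>v\<in>fv E. \<Gamma> v)"

definition cond_env :: "'v set \<Rightarrow> 'm \<Rightarrow> ('v \<Rightarrow> 'm::comm_quantale) \<Rightarrow> ('v \<Rightarrow> 'm) \<Rightarrow> ('v \<Rightarrow> 'm) \<Rightarrow> 'v \<Rightarrow> 'm" where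
  "cond_env X t \<Gamma> \<Gamma>1 \<Gamma>2 = (\<lambda>x. if x \<in> X then t * sup (\<Gamma>1 x) (\<Gamma>2 x) else \<Gamma> x)"

definition while_env :: "'v set \<Rightarrow> 'm \<Rightarrow> ('v \<Rightarrow> 'm::comm_quantale) \<Rightarrow> 'v \<Rightarrow> 'm" where
  "while_env X t \<Gamma> = (\<lambda>x. if x \<in> X then qstar t * \<Gamma> x else \<Gamma> x)"

text \<open>The \<open>M\<close>-system is the instance of \<open>derives\<close> at the quantale type \<open>'m\<close>. The affineness
  premises keep every context in \<open>M\<^sub>1\<close> and every environment in \<open>Var \<rightarrow> M\<^sub>1\<close>.\<close>

inductive derives ::
  "('e \<Rightarrow> 'v::finite set) \<Rightarrow> 'm::comm_quantale \<Rightarrow> ('v \<Rightarrow> 'm) \<Rightarrow> ('v, 'e) com \<Rightarrow> ('v \<Rightarrow> 'm) \<Rightarrow> bool"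
  for fv :: "'e \<Rightarrow> 'v::finite set" where
  SkipR: "\<lbrakk>p \<in> affine; affine_env \<Gamma>\<rbrakk> \<Longrightarrow> derives fv p \<Gamma> Skip \<Gamma>"
| AssignR: "\<lbrakk>p \<in> affine; affine_env \<Gamma>\<rbrakk> \<Longrightarrow>
    derives fv p \<Gamma> (Assign x E) (\<Gamma>(x := p * texp fv E \<Gamma>))"
| SeqR: "\<lbrakk>derives fv p \<Gamma> C1 \<Gamma>''; derives fv p \<Gamma>'' C2 \<Gamma>'\<rbrakk> \<Longrightarrow> derives fv p \<Gamma> (Seq C1 C2) \<Gamma>'"
| CondR: "\<lbrakk>p \<in> affine; t = texp fv E \<Gamma>; derives fv (p * t) \<Gamma> C1 \<Gamma>1; derives fv (p * t) \<Gamma> C2 \<Gamma>2\<rbrakk> \<Longrightarrow>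
    derives fv p \<Gamma> (Cond E C1 C2) (cond_env (asgn C1 \<union> asgn C2) t \<Gamma> \<Gamma>1 \<Gamma>2)"
| WhileR: "\<lbrakk>p \<in> affine; t = texp fv E \<Gamma>; derives fv (p * t) \<Gamma> C \<Gamma>\<rbrakk> \<Longrightarrow>
    derives fv p \<Gamma> (While E C) (while_env (asgn C) t \<Gamma>)"
| SubR: "\<lbrakk>derives fv p \<Gamma> C \<Gamma>1'; p' \<in> affine; affine_env \<Gamma>'; p' \<le> p; \<Gamma>' \<le> \<Gamma>; \<Gamma>1' \<le> \<Gamma>2'\<rbrakk> \<Longrightarrow>
    derives fv p' \<Gamma>' C \<Gamma>2'"

section \<open>The algorithmic system\<close>

text \<open>In the loop case the fixed point is taken among all functions \<open>'v \<Rightarrow> 'm\<close>. Every pre-fixed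
  point lies above \<open>\<Gamma>\<close>, so for affine \<open>\<Gamma>\<close> this is the least fixed point among affine environments.\<close>

primrec alg ::
  "('e \<Rightarrow> 'v::finite set) \<Rightarrow> ('v, 'e) com \<Rightarrow> 'm::comm_quantale \<Rightarrow> ('v \<Rightarrow> 'm) \<Rightarrow> 'v \<Rightarrow> 'm" where
  "alg fv Skip p \<Gamma> = \<Gamma>"
| "alg fv (Assign x E) p \<Gamma> = \<Gamma>(x := p * texp fv E \<Gamma>)"
| "alg fv (Seq C1 C2) p \<Gamma> = alg fv C2 p (alg fv C1 p \<Gamma>)"
| "alg fv (Cond E C1 C2) p \<Gamma> =
    (let t = texp fv E \<Gamma>
     in cond_env (asgn C1 \<union> asgn C2) t \<Gamma> (alg fv C1 (p * t) \<Gamma>) (alg fv C2 (p * t) \<Gamma>))"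
| "alg fv (While E C) p \<Gamma> =
    (let \<Gamma>s = lfp (\<lambda>\<Theta>. sup \<Gamma> (alg fv C (p * texp fv E \<Theta>) \<Theta>))
     in while_env (asgn C) (texp fv E \<Gamma>s) \<Gamma>s)"

definition Delta :: "('e \<Rightarrow> 'v::finite set) \<Rightarrow> ('v, 'e) com \<Rightarrow> 'v \<Rightarrow> 'v mdown" where
  "Delta fv C = alg fv C 1 gen"

text \<open>\<open>\<Delta>\<close> is a principal typing of \<open>C\<close>, as seen from the \<open>M\<close>-system: it is itself a typing of \<open>C\<close> in
  the universal system, and the \<open>M\<close>-typings of \<open>C\<close> are exactly the weakenings of its images under
  the maps \<open>alpha \<sigma>\<close>. The type argument only selects \<open>M\<close>.\<close>

definition principal_typing ::
  "'m::comm_quantale itself \<Rightarrow> ('e \<Rightarrow> 'v::finite set) \<Rightarrow> ('v, 'e) com \<Rightarrow> ('v \<Rightarrow> 'v mdown) \<Rightarrow> bool" where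
  "principal_typing M fv C \<Delta> \<longleftrightarrow>
    derives fv 1 gen C \<Delta> \<and>
    (\<forall>\<sigma> \<Gamma>' :: 'v \<Rightarrow> 'm. affine_env \<sigma> \<longrightarrow> affine_env \<Gamma>' \<longrightarrow>
      (derives fv 1 \<sigma> C \<Gamma>' \<longleftrightarrow> alpha \<sigma> \<circ> \<Delta> \<le> \<Gamma>'))"

text \<open>The \<open>N\<close>-system certifies the \<open>M\<close>-typing \<open>1 \<turnstile> \<sigma> {C} \<Gamma>'\<close> if some \<open>N\<close>-derivation, read in \<open>M\<close>
  along a map preserving the typing structure laxly, yields that typing. For instance, \<open>alpha \<sigma>\<close>
  reads universal derivations in \<open>M\<close>, and the identity reads \<open>M\<close>-derivations.\<close>

definition certifies ::
  "'n::comm_quantale itself \<Rightarrow> ('e \<Rightarrow> 'v::finite set) \<Rightarrow>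
   ('v \<Rightarrow> 'm::comm_quantale) \<Rightarrow> ('v, 'e) com \<Rightarrow> ('v \<Rightarrow> 'm) \<Rightarrow> bool" where
  "certifies N fv \<sigma> C \<Gamma>' \<longleftrightarrow>
    (\<exists>(f :: 'n \<Rightarrow> 'm) \<Theta> \<Theta>'. lax f \<and> derives fv 1 \<Theta> C \<Theta>' \<and> \<sigma> \<le> f \<circ> \<Theta> \<and> f \<circ> \<Theta>' \<le> \<Gamma>')"

end

theory Submission imports Defs begin

text \<open>The algorithmic system computes the least derivable postcondition, so everything reduces to how
  it transforms under a change of quantale. A lax map \<open>f\<close> satisfies \<open>alg (f p) (f \<circ> \<Gamma>) \<le> f \<circ> alg p \<Gamma>\<close>.
  Applied to \<open>alpha \<sigma>\<close> this bounds \<open>alg 1 \<sigma>\<close> by \<open>alpha \<sigma> \<circ> Delta\<close>; applied to the right adjoint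
  \<open>gamma \<sigma>\<close> and transposed it gives the reverse bound, because \<open>gen \<le> gamma \<sigma> \<circ> \<sigma>\<close> and
  \<open>\<sigma> \<le> alpha \<sigma> \<circ> gen\<close>.\<close>

section \<open>Quantales and lax maps\<close>

text \<open>Only distributivity over joins is axiomatic. Applied to \<open>Sup {a, b}\<close>, which
  equals \<open>b\<close> here, it yields monotonicity of the tensor.\<close>

lemma quantale_mult_left_mono:
  fixes a b c :: "'m::comm_quantale"
  assumes "a \<le> b"
  shows "c * a \<le> c * b"
proof -
  have "c * b = c * Sup {a, b}"
    using assms by (simp add: sup_absorb2)
  also have "\<dots> = sup (c * a) (c * b)"
    unfolding mult_Sup_distrib by simp
  finally show ?thesis
    by (metis sup_ge1)
qed

lemma quantale_mult_mono:
  fixes a b c d :: "'m::comm_quantale"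
  assumes "a \<le> b" "c \<le> d"
  shows "a * c \<le> b * d"
  by (metis assms mult.commute order_trans quantale_mult_left_mono)

lemma quantale_power_mono:
  fixes a b :: "'m::comm_quantale"
  assumes "a \<le> b"
  shows "a ^ n \<le> b ^ n"
  by (induction n) (simp_all add: assms quantale_mult_mono)

lemma quantale_prod_mono:
  fixes f g :: "'a \<Rightarrow> 'm::comm_quantale"
  assumes "\<And>x. x \<in> A \<Longrightarrow> f x \<le> g x"
  shows "prod f A \<le> prod g A"
  using assms by (induction A rule: infinite_finite_induct) (simp_all add: quantale_mult_mono)

lemma SUP_mult_SUP:
  fixes f :: "'a \<Rightarrow> 'm::comm_quantale" and g :: "'b \<Rightarrow> 'm"
  shows "(SUP x\<in>A. f x) * (SUP y\<in>B. g y) = (SUP x\<in>A. SUP y\<in>B. f x * g y)"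
proof -
  have "(SUP x\<in>A. f x) * (SUP y\<in>B. g y) = (SUP y\<in>B. SUP x\<in>A. g y * f x)"
    by (simp add: mult_Sup_distrib image_image mult.commute[of "Sup _"])
  also have "\<dots> = (SUP x\<in>A. SUP y\<in>B. f x * g y)"
    by (subst SUP_commute) (simp add: mult.commute)
  finally show ?thesis .
qed

section \<open>Affine elements and affine environments\<close>

lemma affine_mult: "a \<in> affine \<Longrightarrow> b \<in> affine \<Longrightarrow> a * b \<in> affine"
  using quantale_mult_mono[of 1 a 1 b] by (simp add: affine_def)

lemma affine_up: "a \<in> affine \<Longrightarrow> a \<le> b \<Longrightarrow> b \<in> affine"
  by (auto simp: affine_def)

lemma affine_one: "1 \<in> affine"
  by (simp add: affine_def)

text \<open>The extra factors form a power above \<open>1\<close>, so they can only enlarge the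
  product. This later makes weights of multisets monotone.\<close>

lemma affine_power_increasing:
  assumes "a \<in> affine" "m \<le> n"
  shows "a ^ m \<le> a ^ n"
proof -
  have "1 \<le> a ^ (n - m)"
    using quantale_power_mono[of 1 a "n - m"] assms(1) by (simp add: affine_def)
  then have "a ^ m * 1 \<le> a ^ m * a ^ (n - m)"
    by (rule quantale_mult_left_mono)
  with assms(2) show ?thesis
    by (simp flip: power_add)
qed

lemma qstar_mono: "a \<le> b \<Longrightarrow> qstar a \<le> qstar b"
  unfolding qstar_def by (intro SUP_mono') (rule quantale_power_mono)

lemma affine_qstar: "qstar a \<in> affine"
  unfolding affine_def qstar_def by (simp add: SUP_upper2[of 0])

lemma affine_envI: "(\<And>x. \<Gamma> x \<in> affine) \<Longrightarrow> affine_env \<Gamma>"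
  by (auto simp: affine_env_def)

lemma affine_envD: "affine_env \<Gamma> \<Longrightarrow> \<Gamma> x \<in> affine"
  by (auto simp: affine_env_def)

lemma affine_env_up: "affine_env \<Gamma> \<Longrightarrow> \<Gamma> \<le> \<Gamma>' \<Longrightarrow> affine_env \<Gamma>'"
  by (metis affine_envI affine_envD affine_up le_funD)

lemma texp_mono: "\<Gamma> \<le> \<Gamma>' \<Longrightarrow> texp fv E \<Gamma> \<le> texp fv E \<Gamma>'"
  unfolding texp_def by (intro quantale_prod_mono) (simp add: le_funD)

lemma affine_texp:
  assumes "affine_env \<Gamma>"
  shows "texp fv E \<Gamma> \<in> affine"
  using quantale_prod_mono[of "fv E" "\<lambda>_. 1" \<Gamma>] affine_envD[OF assms]
  by (simp add: affine_def texp_def)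

lemma cond_env_mono:
  assumes "t \<le> t'" "\<Gamma> \<le> \<Gamma>'" "\<Gamma>1 \<le> \<Gamma>1'" "\<Gamma>2 \<le> \<Gamma>2'"
  shows "cond_env X t \<Gamma> \<Gamma>1 \<Gamma>2 \<le> cond_env X t' \<Gamma>' \<Gamma>1' \<Gamma>2'"
  using assms by (auto simp: cond_env_def le_fun_def intro!: quantale_mult_mono sup_mono)

lemma while_env_mono:
  assumes "t \<le> t'" "\<Gamma> \<le> \<Gamma>'"
  shows "while_env X t \<Gamma> \<le> while_env X t' \<Gamma>'"
  using assms by (auto simp: while_env_def le_fun_def intro!: quantale_mult_mono qstar_mono)

lemma affine_cond_env:
  assumes "t \<in> affine" "affine_env \<Gamma>" "affine_env \<Gamma>1"
  shows "affine_env (cond_env X t \<Gamma> \<Gamma>1 \<Gamma>2)"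
proof (rule affine_envI)
  fix x
  have "sup (\<Gamma>1 x) (\<Gamma>2 x) \<in> affine"
    by (rule affine_up[OF affine_envD[OF assms(3), of x]]) simp
  with assms show "cond_env X t \<Gamma> \<Gamma>1 \<Gamma>2 x \<in> affine"
    by (simp add: cond_env_def affine_mult affine_envD)
qed

lemma affine_while_env: "affine_env \<Gamma> \<Longrightarrow> affine_env (while_env X t \<Gamma>)"
  by (auto simp: while_env_def intro!: affine_envI affine_mult affine_qstar dest: affine_envD)

section \<open>Lax maps and the environment formers\<close>

lemma lax_monoD: "lax f \<Longrightarrow> a \<le> b \<Longrightarrow> f a \<le> f b"
  by (simp add: lax_def monoD)

lemma lax_multD: "lax f \<Longrightarrow> f a * f b \<le> f (a * b)"
  by (simp add: lax_def)

lemma lax_oneD: "lax f \<Longrightarrow> 1 \<le> f 1"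
  by (simp add: lax_def)

lemma lax_prod:
  assumes "lax f"
  shows "(\<Prod>x\<in>A. f (g x)) \<le> f (\<Prod>x\<in>A. g x)"
proof (induction A rule: infinite_finite_induct)
  case (insert x F)
  have "f (g x) * (\<Prod>y\<in>F. f (g y)) \<le> f (g x) * f (\<Prod>y\<in>F. g y)"
    by (rule quantale_mult_left_mono[OF insert.IH])
  also have "\<dots> \<le> f (g x * (\<Prod>y\<in>F. g y))"
    by (rule lax_multD[OF assms])
  finally show ?case
    using insert.hyps by simp
\<comment> \<open>Besides the empty tensor this covers infinite \<open>A\<close>, where
  \<open>prod\<close> defaults to \<open>1\<close>.\<close>
qed (simp_all add: lax_oneD[OF assms])

lemma lax_texp: "lax f \<Longrightarrow> texp fv E (f \<circ> \<Gamma>) \<le> f (texp fv E \<Gamma>)"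
  unfolding texp_def comp_def by (rule lax_prod)

lemma lax_qstar:
  assumes "lax f"
  shows "qstar (f t) \<le> f (qstar t)"
  unfolding qstar_def
proof (rule SUP_least)
  fix n :: nat
  have "f t ^ n \<le> f (t ^ n)"
    \<comment> \<open>A power is the tensor of a constant family over \<open>n\<close>
      indices.\<close>
    using lax_prod[OF assms, of "\<lambda>_. t" "{..<n}"] by simp
  also have "\<dots> \<le> f (SUP n. t ^ n)"
    by (rule lax_monoD[OF assms]) (simp add: SUP_upper)
  finally show "f t ^ n \<le> f (SUP n. t ^ n)" .
qed

lemma lax_mult_le:
  assumes "lax f" "a \<le> f b" "c \<le> f d"
  shows "a * c \<le> f (b * d)"
  using quantale_mult_mono[OF assms(2,3)] lax_multD[OF assms(1)] by (rule order_trans)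

text \<open>The tensor passes through \<open>f\<close> by laxness, the join by monotonicity. The
  branches enter through inequalities so that induction hypotheses fit.\<close>

lemma lax_cond_env:
  assumes "lax f" "t' \<le> f t" "\<Gamma>1' \<le> f \<circ> \<Gamma>1" "\<Gamma>2' \<le> f \<circ> \<Gamma>2"
  shows "cond_env X t' (f \<circ> \<Gamma>) \<Gamma>1' \<Gamma>2' \<le> f \<circ> cond_env X t \<Gamma> \<Gamma>1 \<Gamma>2"
proof (rule le_funI)
  fix x
  have "sup (\<Gamma>1' x) (\<Gamma>2' x) \<le> sup (f (\<Gamma>1 x)) (f (\<Gamma>2 x))"
    using assms(3,4) by (intro sup_mono) (auto simp: le_fun_def)
  also have "\<dots> \<le> f (sup (\<Gamma>1 x) (\<Gamma>2 x))"
    by (intro sup_least lax_monoD[OF assms(1)]) simp_all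
  finally show "cond_env X t' (f \<circ> \<Gamma>) \<Gamma>1' \<Gamma>2' x \<le> (f \<circ> cond_env X t \<Gamma> \<Gamma>1 \<Gamma>2) x"
    by (simp add: cond_env_def lax_mult_le[OF assms(1,2)])
qed

lemma lax_while_env:
  assumes "lax f" "t' \<le> f t"
  shows "while_env X t' (f \<circ> \<Gamma>) \<le> f \<circ> while_env X t \<Gamma>"
  using lax_mult_le[OF assms(1) order_trans[OF qstar_mono[OF assms(2)] lax_qstar[OF assms(1)]]]
  by (simp add: while_env_def le_fun_def)

section \<open>The algorithmic system\<close>

text \<open>In the loop case a pointwise larger step has a larger least fixed point. Through
  \<open>mono_alg_step\<close> the result also ensures that the \<open>lfp\<close> of a loop is a
  genuine fixed point.\<close>

lemma alg_mono:
  assumes "p \<le> p'" "\<Gamma> \<le> \<Gamma>'"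
  shows "alg fv C p \<Gamma> \<le> alg fv C p' \<Gamma>'"
  using assms
proof (induction C arbitrary: p p' \<Gamma> \<Gamma>')
  case (Assign x E)
  then show ?case
    using texp_mono[OF Assign.prems(2), of fv E]
    by (auto simp: le_fun_def intro!: quantale_mult_mono)
next
  case (Cond E C1 C2)
  show ?case
    unfolding alg.simps Let_def
    by (intro cond_env_mono texp_mono Cond.IH quantale_mult_mono Cond.prems)
next
  case (While E C)
  show ?case
    unfolding alg.simps Let_def
    by (intro while_env_mono texp_mono lfp_mono sup_mono While.IH quantale_mult_mono While.prems
        order_refl)
qed simp_all

lemma mono_alg_step: "mono (\<lambda>\<Theta>. sup \<Gamma> (alg fv C (p * texp fv E \<Theta>) \<Theta>))"
  by (intro monoI sup_mono alg_mono quantale_mult_mono texp_mono order_refl)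

text \<open>Each environment former is compatible with \<open>f\<close>, and \<open>alg_mono\<close>
  lets the bounds for subcommands be nested.\<close>

lemma lax_alg:
  assumes "lax f"
  shows "alg fv C (f p) (f \<circ> \<Gamma>) \<le> f \<circ> alg fv C p \<Gamma>"
proof (induction C arbitrary: p \<Gamma>)
  case (Assign x E)
  show ?case
    using lax_mult_le[OF assms order_refl lax_texp[OF assms], of p fv E \<Gamma>]
    by (simp add: le_fun_def comp_def)
next
  case (Seq C1 C2)
  have "alg fv C2 (f p) (alg fv C1 (f p) (f \<circ> \<Gamma>)) \<le> alg fv C2 (f p) (f \<circ> alg fv C1 p \<Gamma>)"
    by (intro alg_mono order_refl Seq.IH)
  also have "\<dots> \<le> f \<circ> alg fv C2 p (alg fv C1 p \<Gamma>)"
    by (rule Seq.IH)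
  finally show ?case
    by (simp only: alg.simps)
next
  case (Cond E C1 C2)
  show ?case
    unfolding alg.simps Let_def
    by (intro lax_cond_env lax_texp assms order_trans[OF alg_mono Cond.IH(1)]
        order_trans[OF alg_mono Cond.IH(2)] lax_mult_le order_refl)
next
  case (While E C)
  define F where "F = (\<lambda>\<Theta>. sup \<Gamma> (alg fv C (p * texp fv E \<Theta>) \<Theta>))"
  define G where "G = (\<lambda>\<Theta>. sup (f \<circ> \<Gamma>) (alg fv C (f p * texp fv E \<Theta>) \<Theta>))"
  have F_fix: "F (lfp F) = lfp F"
    unfolding F_def by (rule lfp_fixpoint[OF mono_alg_step])
  \<comment> \<open>It suffices that \<open>f \<circ> lfp F\<close> is a pre-fixed point of the
    target step \<open>G\<close>. This works even when \<open>f\<close> fails to preserve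
    joins.\<close>
  have "lfp G \<le> f \<circ> lfp F"
  proof (rule lfp_lowerbound)
    have "alg fv C (f p * texp fv E (f \<circ> lfp F)) (f \<circ> lfp F)
        \<le> alg fv C (f (p * texp fv E (lfp F))) (f \<circ> lfp F)"
      by (intro alg_mono lax_mult_le lax_texp assms order_refl)
    also have "\<dots> \<le> f \<circ> alg fv C (p * texp fv E (lfp F)) (lfp F)"
      by (rule While.IH)
    finally have "G (f \<circ> lfp F) \<le> sup (f \<circ> \<Gamma>) (f \<circ> alg fv C (p * texp fv E (lfp F)) (lfp F))"
      unfolding G_def by (rule sup_mono[OF order_refl])
    also have "\<dots> \<le> f \<circ> F (lfp F)"
      by (auto simp: F_def le_fun_def intro!: lax_monoD[OF assms])
    finally show "G (f \<circ> lfp F) \<le> f \<circ> lfp F"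
      by (simp add: F_fix)
  qed
  then have "while_env (asgn C) (texp fv E (lfp G)) (lfp G)
      \<le> while_env (asgn C) (texp fv E (f \<circ> lfp F)) (f \<circ> lfp F)"
    by (intro while_env_mono texp_mono)
  also have "\<dots> \<le> f \<circ> while_env (asgn C) (texp fv E (lfp F)) (lfp F)"
    by (intro lax_while_env lax_texp assms)
  finally show ?case
    by (simp only: alg.simps F_def G_def Let_def)
qed simp

section \<open>Derivability versus the algorithm\<close>

lemma derives_affine:
  assumes "derives fv p \<Gamma> C \<Gamma>'"
  shows "p \<in> affine \<and> affine_env \<Gamma> \<and> affine_env \<Gamma>'"
  using assms
proof (induction rule: derives.induct)
  case (AssignR p \<Gamma> x E)
  then show ?case
    by (auto intro!: affine_envI affine_mult affine_texp dest: affine_envD)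
next
  case (CondR p t E \<Gamma> C1 \<Gamma>1 C2 \<Gamma>2)
  then show ?case
    by (simp add: affine_cond_env affine_texp)
next
  case (SubR p \<Gamma> C \<Gamma>1' p' \<Gamma>' \<Gamma>2')
  then show ?case
    using affine_env_up by blast
qed (simp_all add: affine_while_env)

text \<open>The syntax-directed rules mirror the clauses of \<open>alg\<close>, and
  \<open>SubR\<close> is absorbed by monotonicity.\<close>

lemma derives_alg_le:
  assumes "derives fv p \<Gamma> C \<Gamma>'"
  shows "alg fv C p \<Gamma> \<le> \<Gamma>'"
  using assms
proof (induction rule: derives.induct)
  case (SeqR p \<Gamma> C1 \<Gamma>'' C2 \<Gamma>')
  then show ?case
    using alg_mono[OF order_refl SeqR.IH(1)] by (auto intro: order_trans)
next
  case (CondR p t E \<Gamma> C1 \<Gamma>1 C2 \<Gamma>2)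
  then show ?case
    by (auto simp: Let_def intro!: cond_env_mono)
next
  case (WhileR p t E \<Gamma> C)
  \<comment> \<open>By the induction hypothesis the invariant \<open>\<Gamma>\<close> of the rule is
    a pre-fixed point of the step.\<close>
  have "lfp (\<lambda>\<Theta>. sup \<Gamma> (alg fv C (p * texp fv E \<Theta>) \<Theta>)) \<le> \<Gamma>"
    by (rule lfp_lowerbound) (use WhileR in simp)
  then show ?case
    unfolding alg.simps Let_def WhileR.hyps by (intro while_env_mono texp_mono)
next
  case (SubR p \<Gamma> C \<Gamma>1' p' \<Gamma>' \<Gamma>2')
  then show ?case
    using alg_mono[OF SubR.hyps(4,5)] by (blast intro: order_trans)
qed simp_all

text \<open>In the loop case the least fixed point is itself an invariant, so \<open>WhileR\<close>
  applies to it, and \<open>SubR\<close> brings the precondition back down to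
  \<open>\<Gamma>\<close>.\<close>

lemma derives_alg:
  assumes "p \<in> affine" "affine_env \<Gamma>"
  shows "derives fv p \<Gamma> C (alg fv C p \<Gamma>)"
  using assms
proof (induction C arbitrary: p \<Gamma>)
  case (Seq C1 C2)
  then show ?case
    using derives_affine by (fastforce intro: SeqR)
next
  case (Cond E C1 C2)
  then show ?case
    by (simp add: Let_def CondR affine_mult affine_texp)
next
  case (While E C)
  define \<Theta> where "\<Theta> = lfp (\<lambda>\<Theta>. sup \<Gamma> (alg fv C (p * texp fv E \<Theta>) \<Theta>))"
  have fix_eq: "sup \<Gamma> (alg fv C (p * texp fv E \<Theta>) \<Theta>) = \<Theta>"
    unfolding \<Theta>_def by (rule lfp_fixpoint[OF mono_alg_step])
  have "\<Gamma> \<le> \<Theta>" and step: "alg fv C (p * texp fv E \<Theta>) \<Theta> \<le> \<Theta>"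
    by (metis fix_eq sup_ge1, metis fix_eq sup_ge2)
  have aff: "affine_env \<Theta>"
    using While.prems(2) \<open>\<Gamma> \<le> \<Theta>\<close> by (rule affine_env_up)
  have p: "p * texp fv E \<Theta> \<in> affine"
    by (intro affine_mult While.prems affine_texp aff)
  \<comment> \<open>\<open>WhileR\<close> asks for the same environment before and after the body,
    so the postcondition is raised to \<open>\<Theta>\<close>.\<close>
  have "derives fv (p * texp fv E \<Theta>) \<Theta> C \<Theta>"
    by (rule SubR[OF While.IH[OF p aff] p aff order_refl order_refl step])
  then have "derives fv p \<Theta> (While E C) (while_env (asgn C) (texp fv E \<Theta>) \<Theta>)"
    by (rule WhileR[OF While.prems(1) refl])
  then have "derives fv p \<Gamma> (While E C) (while_env (asgn C) (texp fv E \<Theta>) \<Theta>)"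
    by (rule SubR) (use While.prems \<open>\<Gamma> \<le> \<Theta>\<close> in auto)
  then show ?case
    by (simp add: \<Theta>_def Let_def)
qed (simp_all add: SkipR AssignR)

text \<open>From here on, questions about derivations become inequalities between
  environments.\<close>

lemma derives_iff_alg:
  assumes "p \<in> affine" "affine_env \<Gamma>"
  shows "derives fv p \<Gamma> C \<Gamma>' \<longleftrightarrow> alg fv C p \<Gamma> \<le> \<Gamma>'"
  using SubR[OF derives_alg[OF assms] assms order_refl order_refl] derives_alg_le by blast

text \<open>The foreign postcondition lies above the foreign algorithmic one, and
  \<open>lax_alg\<close> compares the latter, read along \<open>f\<close>, with
  \<open>alg fv C 1 \<sigma>\<close>.\<close>

lemma certifies_derives:
  fixes \<sigma> :: "'v::finite \<Rightarrow> 'm::comm_quantale"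
  assumes "affine_env \<sigma>" "certifies TYPE('n::comm_quantale) fv \<sigma> C \<Gamma>'"
  shows "derives fv 1 \<sigma> C \<Gamma>'"
proof -
  obtain f :: "'n \<Rightarrow> 'm" and \<Theta> \<Theta>' where f: "lax f" and der: "derives fv 1 \<Theta> C \<Theta>'"
    and le: "\<sigma> \<le> f \<circ> \<Theta>" "f \<circ> \<Theta>' \<le> \<Gamma>'"
    using assms(2) unfolding certifies_def by blast
  have "alg fv C 1 \<sigma> \<le> alg fv C (f 1) (f \<circ> \<Theta>)"
    using lax_oneD[OF f] le(1) by (rule alg_mono)
  also have "\<dots> \<le> f \<circ> alg fv C 1 \<Theta>"
    by (rule lax_alg[OF f])
  also have "\<dots> \<le> f \<circ> \<Theta>'"
    using derives_alg_le[OF der] by (simp add: le_fun_def lax_monoD[OF f])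
  finally show ?thesis
    using le(2) by (simp add: derives_iff_alg[OF affine_one assms(1)])
qed

section \<open>The adjunction with the multiset object\<close>

lemma affine_env_gen: "affine_env gen"
  by (rule affine_envI)
    (auto simp: affine_def less_eq_mdown.rep_eq one_mdown.rep_eq gen.rep_eq le_fun_def)

text \<open>Joins of downsets are unions, so a multiset in \<open>gamma \<sigma> x\<close> already
  lies in some \<open>B\<close> with \<open>alpha \<sigma> B \<le> x\<close>, which bounds its
  weight.\<close>

lemma alpha_gamma_adjoint: "alpha \<sigma> A \<le> x \<longleftrightarrow> A \<le> gamma \<sigma> x"
proof
  assume "alpha \<sigma> A \<le> x"
  then show "A \<le> gamma \<sigma> x"
    unfolding gamma_def by (simp add: Sup_upper)
next
  assume "A \<le> gamma \<sigma> x"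
  then have sub: "Rep_mdown A \<subseteq> (\<Union>B\<in>{B. alpha \<sigma> B \<le> x}. Rep_mdown B)"
    by (simp add: gamma_def less_eq_mdown.rep_eq Sup_mdown.rep_eq)
  show "alpha \<sigma> A \<le> x"
    unfolding alpha_def
  proof (rule SUP_least)
    fix m assume "m \<in> Rep_mdown A"
    with sub obtain B where "alpha \<sigma> B \<le> x" "m \<in> Rep_mdown B"
      by blast
    then show "(\<Prod>v\<in>UNIV. \<sigma> v ^ m v) \<le> x"
      unfolding alpha_def by (meson SUP_le_iff)
  qed
qed

lemma mono_alpha: "mono (alpha \<sigma>)"
  unfolding alpha_def by (intro monoI SUP_subset_mono) (simp_all add: less_eq_mdown.rep_eq)

lemma mono_gamma: "mono (gamma \<sigma>)"
  by (rule monoI) (metis alpha_gamma_adjoint order_refl order_trans)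

text \<open>Because of this monotonicity, downward closure adds nothing to a join of
  weights.\<close>

lemma prod_power_mono:
  assumes "affine_env \<sigma>" "m \<le> n"
  shows "(\<Prod>v\<in>A. \<sigma> v ^ m v) \<le> (\<Prod>v\<in>A. \<sigma> v ^ n v)"
  using assms by (intro quantale_prod_mono affine_power_increasing) (auto simp: affine_envD le_funD)

text \<open>Both halves of the equality matter: \<open>\<ge>\<close> makes
  \<open>alpha \<sigma>\<close> lax, and \<open>\<le>\<close> makes its right adjoint lax.\<close>

lemma alpha_mult:
  assumes "affine_env \<sigma>"
  shows "alpha \<sigma> (A * B) = alpha \<sigma> A * alpha \<sigma> B"
proof (rule order_antisym)
  let ?w = "\<lambda>m. \<Prod>v\<in>UNIV. \<sigma> v ^ m v"
  show "alpha \<sigma> (A * B) \<le> alpha \<sigma> A * alpha \<sigma> B"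
    unfolding alpha_def
  proof (rule SUP_least)
    fix k assume "k \<in> Rep_mdown (A * B)"
    then obtain m n where mn: "m \<in> Rep_mdown A" "n \<in> Rep_mdown B" "k \<le> (\<lambda>v. m v + n v)"
      by (auto simp: times_mdown.rep_eq)
    \<comment> \<open>Membership in the tensor only places \<open>k\<close> below a sum, so
      affineness enters here.\<close>
    have "?w k \<le> ?w (\<lambda>v. m v + n v)"
      using assms mn(3) by (rule prod_power_mono)
    also have "\<dots> = ?w m * ?w n"
      by (simp add: power_add prod.distrib)
    also have "\<dots> \<le> (SUP m\<in>Rep_mdown A. ?w m) * (SUP n\<in>Rep_mdown B. ?w n)"
      using mn by (intro quantale_mult_mono SUP_upper)
    finally show "?w k \<le> (SUP m\<in>Rep_mdown A. ?w m) * (SUP n\<in>Rep_mdown B. ?w n)" .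
  qed
  show "alpha \<sigma> A * alpha \<sigma> B \<le> alpha \<sigma> (A * B)"
    unfolding alpha_def SUP_mult_SUP
  proof (intro SUP_least)
    fix m n assume "m \<in> Rep_mdown A" "n \<in> Rep_mdown B"
    then have "(\<lambda>v. m v + n v) \<in> Rep_mdown (A * B)"
      by (auto simp: times_mdown.rep_eq)
    then have "?w (\<lambda>v. m v + n v) \<le> (SUP k\<in>Rep_mdown (A * B). ?w k)"
      by (rule SUP_upper)
    then show "?w m * ?w n \<le> (SUP k\<in>Rep_mdown (A * B). ?w k)"
      by (simp add: power_add prod.distrib)
  qed
qed

lemma alpha_one:
  fixes \<sigma> :: "'v::finite \<Rightarrow> 'm::comm_quantale"
  shows "alpha \<sigma> 1 = 1"
proof -
  have "Rep_mdown 1 = {\<lambda>_::'v. 0}"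
    by (auto simp: one_mdown.rep_eq le_fun_def)
  then show ?thesis
    by (simp add: alpha_def)
qed

text \<open>The unit vector is the largest multiset in \<open>gen v\<close>, so by affineness its
  weight is the whole join.\<close>

lemma alpha_gen:
  assumes "affine_env \<sigma>"
  shows "alpha \<sigma> (gen v) = \<sigma> v"
proof -
  let ?e = "\<lambda>w. if w = v then 1 else 0 :: nat"
  have unit: "(\<Prod>w\<in>UNIV. \<sigma> w ^ ?e w) = \<sigma> v"
    by (simp add: if_distrib[of "\<lambda>n. _ ^ n"] prod.delta cong: if_cong)
  show ?thesis
  proof (rule order_antisym)
    show "alpha \<sigma> (gen v) \<le> \<sigma> v"
      unfolding alpha_def gen.rep_eq
      by (rule SUP_least) (metis (no_types) unit prod_power_mono[OF assms] mem_Collect_eq)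
    show "\<sigma> v \<le> alpha \<sigma> (gen v)"
      unfolding alpha_def gen.rep_eq by (rule SUP_upper2[of ?e])
        (simp_all only: unit mem_Collect_eq order_refl)
  qed
qed

lemma lax_alpha: "affine_env \<sigma> \<Longrightarrow> lax (alpha \<sigma>)"
  by (simp add: lax_def mono_alpha alpha_mult alpha_one)

text \<open>The right adjoint of an oplax monoidal map is lax monoidal: transpose, split with
  \<open>alpha_mult\<close>, then apply the counit to each factor.\<close>

lemma lax_gamma:
  assumes "affine_env \<sigma>"
  shows "lax (gamma \<sigma>)"
proof -
  have "alpha \<sigma> (gamma \<sigma> a) \<le> a" for a
    by (simp add: alpha_gamma_adjoint)
  then have "gamma \<sigma> a * gamma \<sigma> b \<le> gamma \<sigma> (a * b)" for a b
    by (simp add: alpha_mult[OF assms] quantale_mult_mono flip: alpha_gamma_adjoint)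
  moreover have "1 \<le> gamma \<sigma> 1"
    by (simp add: alpha_one flip: alpha_gamma_adjoint)
  ultimately show ?thesis
    by (simp add: lax_def mono_gamma)
qed

section \<open>Transfer between the universal system and the \<open>M\<close>-system\<close>

lemma alpha_gamma_env: "alpha \<sigma> \<circ> \<Gamma> \<le> \<Gamma>' \<longleftrightarrow> \<Gamma> \<le> gamma \<sigma> \<circ> \<Gamma>'"
  by (simp add: le_fun_def alpha_gamma_adjoint)

text \<open>For a single map \<open>lax_alg\<close> gives one inequality; using it for both adjoints
  gives equality, which is why the principal bound is attained.\<close>

lemma alpha_Delta:
  assumes "affine_env \<sigma>"
  shows "alpha \<sigma> \<circ> Delta fv C = alg fv C 1 \<sigma>"
proof (rule order_antisym)
  have gens: "alpha \<sigma> \<circ> gen = \<sigma>"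
    by (simp add: fun_eq_iff alpha_gen[OF assms])
  \<comment> \<open>The transpose of \<open>gens\<close> raises \<open>gen\<close> to
    \<open>gamma \<sigma> \<circ> \<sigma>\<close>, and lax unitality raises the context
    \<open>1\<close>.\<close>
  have "Delta fv C \<le> alg fv C (gamma \<sigma> 1) (gamma \<sigma> \<circ> \<sigma>)"
    unfolding Delta_def using gens
    by (intro alg_mono lax_oneD lax_gamma assms) (simp flip: alpha_gamma_env)
  also have "\<dots> \<le> gamma \<sigma> \<circ> alg fv C 1 \<sigma>"
    by (rule lax_alg[OF lax_gamma[OF assms]])
  finally show "alpha \<sigma> \<circ> Delta fv C \<le> alg fv C 1 \<sigma>"
    by (simp add: alpha_gamma_env)
  show "alg fv C 1 \<sigma> \<le> alpha \<sigma> \<circ> Delta fv C"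
    using lax_alg[OF lax_alpha[OF assms], of fv C 1 gen] by (simp add: Delta_def gens alpha_one)
qed

lemma derives_iff_alpha_Delta:
  "affine_env \<sigma> \<Longrightarrow> derives fv 1 \<sigma> C \<Gamma>' \<longleftrightarrow> alpha \<sigma> \<circ> Delta fv C \<le> \<Gamma>'"
  by (simp add: derives_iff_alg affine_one alpha_Delta)

lemma derives_gen_iff: "derives fv 1 gen C \<Gamma>'' \<longleftrightarrow> Delta fv C \<le> \<Gamma>''"
  by (simp add: derives_iff_alg affine_one affine_env_gen Delta_def)

lemma principal_typing_Delta: "principal_typing TYPE('m::comm_quantale) fv C (Delta fv C)"
  by (simp add: principal_typing_def derives_gen_iff derives_iff_alpha_Delta)

text \<open>The type \<open>'n\<close> is an arbitrary quantale, so the last item covers every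
  member of the family; its final conjunct is internal completeness.\<close>

theorem theorem2:
  fixes fv :: "'e \<Rightarrow> 'v::finite set"
    and \<sigma> :: "'v \<Rightarrow> 'm::comm_quantale"
  assumes "affine_env \<sigma>"
  shows
    "((\<forall>A x. alpha \<sigma> A \<le> x \<longleftrightarrow> A \<le> gamma \<sigma> x) \<and> lax (alpha \<sigma>) \<and> lax (gamma \<sigma>)) \<and>
     (\<forall>C \<Gamma>'. affine_env \<Gamma>' \<longrightarrow>
        (derives fv 1 \<sigma> C \<Gamma>' \<longleftrightarrow> (\<exists>\<Gamma>''. derives fv 1 gen C \<Gamma>'' \<and> \<Gamma>'' \<le> gamma \<sigma> \<circ> \<Gamma>'))) \<and>
     (\<forall>C. (\<forall>\<Gamma>'. affine_env \<Gamma>' \<longrightarrow> (derives fv 1 \<sigma> C \<Gamma>' \<longleftrightarrow> alpha \<sigma> \<circ> Delta fv C \<le> \<Gamma>')) \<and>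
        principal_typing TYPE('m) fv C (Delta fv C)) \<and>
     (\<forall>C. (\<forall>\<Gamma>'. affine_env \<Gamma>' \<longrightarrow> certifies TYPE('n::comm_quantale) fv \<sigma> C \<Gamma>' \<longrightarrow> derives fv 1 \<sigma> C \<Gamma>') \<and>
        derives fv 1 \<sigma> C (alpha \<sigma> \<circ> Delta fv C))"
proof (intro conjI allI impI)
  show "alpha \<sigma> A \<le> x \<longleftrightarrow> A \<le> gamma \<sigma> x" for A x
    by (rule alpha_gamma_adjoint)
  show "lax (alpha \<sigma>)" "lax (gamma \<sigma>)"
    using assms by (rule lax_alpha, rule lax_gamma)
  show "derives fv 1 \<sigma> C \<Gamma>' \<longleftrightarrow> (\<exists>\<Gamma>''. derives fv 1 gen C \<Gamma>'' \<and> \<Gamma>'' \<le> gamma \<sigma> \<circ> \<Gamma>')" for C \<Gamma>'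
    \<comment> \<open>As the least universal postcondition, \<open>Delta fv C\<close> is the
      witness; the converse is transitivity.\<close>
    unfolding derives_iff_alpha_Delta[OF assms] derives_gen_iff alpha_gamma_env
    by (blast intro: order_trans)
  show "derives fv 1 \<sigma> C \<Gamma>' \<longleftrightarrow> alpha \<sigma> \<circ> Delta fv C \<le> \<Gamma>'" for C \<Gamma>'
    by (rule derives_iff_alpha_Delta[OF assms])
  show "principal_typing TYPE('m) fv C (Delta fv C)" for C
    by (rule principal_typing_Delta)
  show "derives fv 1 \<sigma> C \<Gamma>'" if "certifies TYPE('n) fv \<sigma> C \<Gamma>'" for C \<Gamma>'
    using assms that by (rule certifies_derives)
  show "derives fv 1 \<sigma> C (alpha \<sigma> \<circ> Delta fv C)" for C
    by (simp add: derives_iff_alpha_Delta[OF assms])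
qed

end
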